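(* Every finite tree $T$ is $3,2$-perfect.
   Context: All graphs are simple and undirected with nonempty vertex set. A shortest path in a graph $G$ is a path between some vertices $u,v$ (in the same component) whose length (number of edges) equals the graph distance between $u$ and $v$. A set $S\subseteq V(G)$ is $k,d$-independent in $G$ if every shortest path in $G$ of length at most $d$ contains fewer than $k$ vertices of $S$. The $k,d$-chromatic number $\chi^k_d(G)$ is the least positive integer $c$ such that some coloring $V(G)\to\{1,\dots,c\}$ has all color classes $k,d$-independent. A set $S\subseteq V(G)$ is a $k,d$-clique in $G$ if every $k$-element subset of $S$ is contained in some shortest path of $G$ of length at most $d$ (sets with fewer than $k$ elements are vacuously $k,d$-cliques); $\omega^k_d(G)$ is the supremum of the sizes of $k,d$-cliques in $G$. For $2\le k\le d+1$, $G$ is $k,d$-perfect if $\chi^k_d(H)=\left\lceil\frac{\omega^k_d(H)}{k-1}\right\rceil$ for every induced subgraph $H$ of $G$ (shortest paths being computed in $H$). Here $k=3$ and $d=2$. *)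

theory Defs
  imports "Graph_Theory.Graph_Theory"
begin

text \<open>
  A finite simple undirected graph is an element of the locale \<^locale>\<open>graph\<close>: a finite symmetric
  digraph without loops and parallel arcs, every edge \<open>uv\<close> being a pair of opposite arcs.
  That locale admits the null graph; nonemptiness of the vertex set is required separately
  (for trees it is part of connectedness). All invariants below are intended for finite graphs,
  where the minimum in the chromatic number and the supremum in the clique number exist.
\<close>

text \<open>
  The constant \<^const>\<open>tree\<close> of the library is not usable here: in a symmetric digraph an edge
  traversed back and forth is a \<^const>\<open>pre_digraph.cycle\<close> of length 2. Cycles of the undirected
  graph are those of length at least 3.
\<close>

definition undirected_tree :: "('a, 'b) pre_digraph \<Rightarrow> bool" where
  "undirected_tree G \<longleftrightarrow> connected G \<and> \<not> (\<exists>p. pre_digraph.cycle G p \<and> 3 \<le> length p)"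

text \<open>The graph distance is the library's \<^const>\<open>wf_digraph.\<mu>\<close> with unit arc weights.\<close>

definition shortest_path :: "('a, 'b) pre_digraph \<Rightarrow> 'a \<Rightarrow> 'b awalk \<Rightarrow> 'a \<Rightarrow> bool" where
  "shortest_path G u p v \<longleftrightarrow>
     pre_digraph.apath G u p v \<and> ereal (real (length p)) = wf_digraph.\<mu> G (\<lambda>_. 1) u v"

definition kd_independent :: "nat \<Rightarrow> nat \<Rightarrow> ('a, 'b) pre_digraph \<Rightarrow> 'a set \<Rightarrow> bool" where
  "kd_independent k d G S \<longleftrightarrow> S \<subseteq> verts G \<and>
     (\<forall>u p v. shortest_path G u p v \<and> length p \<le> d
        \<longrightarrow> card (S \<inter> set (pre_digraph.awalk_verts G u p)) < k)"

definition kd_colorable :: "nat \<Rightarrow> nat \<Rightarrow> ('a, 'b) pre_digraph \<Rightarrow> nat \<Rightarrow> bool" where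
  "kd_colorable k d G c \<longleftrightarrow>
     (\<exists>f. f ` verts G \<subseteq> {1..c} \<and> (\<forall>i \<in> {1..c}. kd_independent k d G {v \<in> verts G. f v = i}))"

definition kd_chromatic_number :: "nat \<Rightarrow> nat \<Rightarrow> ('a, 'b) pre_digraph \<Rightarrow> nat" where
  "kd_chromatic_number k d G = (LEAST c. 0 < c \<and> kd_colorable k d G c)"

definition kd_clique :: "nat \<Rightarrow> nat \<Rightarrow> ('a, 'b) pre_digraph \<Rightarrow> 'a set \<Rightarrow> bool" where
  "kd_clique k d G S \<longleftrightarrow> S \<subseteq> verts G \<and>
     (\<forall>A \<subseteq> S. card A = k \<longrightarrow>
        (\<exists>u p v. shortest_path G u p v \<and> length p \<le> d
           \<and> A \<subseteq> set (pre_digraph.awalk_verts G u p)))"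

definition kd_clique_number :: "nat \<Rightarrow> nat \<Rightarrow> ('a, 'b) pre_digraph \<Rightarrow> nat" where
  "kd_clique_number k d G = (SUP S \<in> {S. kd_clique k d G S}. card S)"

definition kd_perfect :: "nat \<Rightarrow> nat \<Rightarrow> ('a, 'b) pre_digraph \<Rightarrow> bool" where
  "kd_perfect k d G \<longleftrightarrow> 2 \<le> k \<and> k \<le> d + 1 \<and>
     (\<forall>H. induced_subgraph H G \<and> verts H \<noteq> {} \<longrightarrow>
        int (kd_chromatic_number k d H)
          = \<lceil>real (kd_clique_number k d H) / (real k - 1)\<rceil>)"

end

theory Submission
  imports Defs
begin

text \<open>
  A set of four vertices each of whose triples spans a path with two edges would contain a
  cycle of length 3 or 4, so in a forest no 3,2-clique has more than three vertices. If some
  shortest path has two edges, its vertices form a clique of size 3 that cannot be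
  monochromatic, and a proper 2-colouring of the forest is a valid colouring. Otherwise cliques
  have at most two vertices and one colour suffices.
\<close>

section \<open>Parity of walks, the 2-colouring of a tree, and excluded short cycles\<close>

lemma (in sym_digraph) awalk_reverse:
  assumes "awalk u p v"
  shows "\<exists>q. awalk v q u \<and> length q = length p"
  using assms
proof (induction p arbitrary: u)
  case Nil
  then show ?case by (auto simp: awalk_Nil_iff)
next
  case (Cons e p)
  then have e: "e \<in> arcs G" "tail G e = u" and "awalk (head G e) p v"
    by (auto simp: awalk_Cons_iff)
  then obtain q where q: "awalk v q (head G e)" "length q = length p"
    using Cons.IH by blast
  obtain e' where "e' \<in> arcs G" "tail G e' = head G e" "head G e' = u"
    using sym_arcs e by (metis symmetric_conv)
  then have "awalk (head G e) [e'] u"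
    using e wellformed(1)[OF e(1)] by (simp add: awalk_simps flip: \<open>tail G e' = head G e\<close>)
  with q have "awalk v (q @ [e']) u"
    by (blast intro: awalk_appendI)
  with q show ?case by (metis length_append_singleton length_Cons)
qed

text \<open>A repeated vertex splits the walk into two shorter closed walks, one of which is again
  odd, so strong induction applies. Without repetition the walk is already a \<open>cycle\<close>;
  parity rules out length 2, an edge traversed back and forth.\<close>

lemma (in loopfree_digraph) odd_closed_awalk_imp_cycle:
  assumes "awalk u p u" and "odd (length p)"
  shows "\<exists>c. cycle c \<and> 3 \<le> length c"
  using assms
proof (induction "length p" arbitrary: u p rule: less_induct)
  case less
  show ?case
  proof (cases "distinct (tl (awalk_verts u p))")
    case True
    with less.prems have "cycle p" by (auto simp: cycle_def)
    moreover from this have "2 \<le> length p" unfolding cycle_digraph_conv by blast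
    then have "3 \<le> length p" using less.prems by presburger
    ultimately show ?thesis by blast
  next
    case False
    with less.prems obtain e es where p: "p = e # es" by (cases p) auto
    with False less.prems have es: "awalk (head G e) es u"
      and "\<not> distinct (awalk_verts (head G e) es)"
      by (auto simp: awalk_Cons_iff)
    then obtain q r s w where qrs: "es = q @ r @ s" "0 < length r"
      and w: "awalk (head G e) q w" "awalk w r w" "awalk w s u"
      using awalk_not_distinct_decomp by metis
    show ?thesis
    proof (cases "odd (length r)")
      case True
      with less.hyps[OF _ w(2)] show ?thesis by (simp add: p qrs)
    next
      case False
      have "awalk u (e # q @ s) u"
        using less.prems(1) w by (auto simp: p awalk_Cons_iff)
      with less.hyps[OF _ this] less.prems False qrs show ?thesis by (simp add: p)
    qed
  qed
qed

text \<open>Vertices are coloured by the parity of walks from a root; an edge inside one colour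
  class would close an odd walk and hence yield a cycle.\<close>

lemma undirected_tree_two_colouring:
  fixes T :: "('a, 'b) pre_digraph"
  assumes "graph T" and "undirected_tree T"
  obtains f :: "'a \<Rightarrow> bool" where "\<And>u v. u \<rightarrow>\<^bsub>T\<^esub> v \<Longrightarrow> f u \<noteq> f v"
proof -
  interpret graph T by fact
  have conn: "strongly_connected (mk_symmetric T)"
    using assms by (simp add: undirected_tree_def connected_def)
  then obtain r where r: "r \<in> verts T"
    by (auto simp: strongly_connected_def)
  have walk: "\<exists>p. awalk r p v" if "v \<in> verts T" for v
    using conn r that reachable_mk_symmetric_eq[OF sym_arcs]
    by (auto simp: strongly_connected_def reachable_awalk)
  \<comment> \<open>Asking only for some even walk defines the colour without first showing that all
    walks to a vertex have the same parity.\<close>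
  define f where "f v \<longleftrightarrow> (\<exists>p. awalk r p v \<and> even (length p))" for v
  have "f u \<noteq> f v" if adj: "u \<rightarrow>\<^bsub>T\<^esub> v" for u v
  proof
    assume eq: "f u = f v"
    obtain e where e: "e \<in> arcs T" "tail T e = u" "head T e = v"
      using adj by (auto simp: arcs_ends_conv)
    then have uv: "awalk u [e] v" by (auto simp: awalk_simps)
    show False
    \<comment> \<open>If both ends have even walks, the edge joins them to an odd closed walk at
      \<open>r\<close>. If neither has, the edge extends an odd walk to \<open>u\<close> to an even
      one to \<open>v\<close>.\<close>
    proof (cases "f u")
      case True
      then obtain p q where p: "awalk r p u" "even (length p)" and q: "awalk r q v" "even (length q)"
        using eq f_def by blast
      obtain q' where "awalk v q' r" "length q' = length q"
        using awalk_reverse q by blast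
      with p q uv have "awalk r (p @ [e] @ q') r" "odd (length (p @ [e] @ q'))"
        by (auto intro!: awalk_appendI simp: awalk_simps)
      then show False
        using odd_closed_awalk_imp_cycle assms by (meson undirected_tree_def)
    next
      case False
      obtain p where p: "awalk r p u" using walk e tail_in_verts by blast
      with False have "odd (length p)" by (auto simp: f_def)
      with p uv have "awalk r (p @ [e]) v" "even (length (p @ [e]))"
        by (auto intro!: awalk_appendI)
      then have "f v" using f_def by blast
      with eq False show False by simp
    qed
  qed
  then show thesis by (rule that)
qed

lemma undirected_tree_no_triangle:
  fixes T :: "('a, 'b) pre_digraph"
  assumes "graph T" and "undirected_tree T"
  shows "\<not> (x \<rightarrow>\<^bsub>T\<^esub> y \<and> y \<rightarrow>\<^bsub>T\<^esub> z \<and> z \<rightarrow>\<^bsub>T\<^esub> x)"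
proof -
  obtain f :: "'a \<Rightarrow> bool" where "\<And>u v. u \<rightarrow>\<^bsub>T\<^esub> v \<Longrightarrow> f u \<noteq> f v"
    using undirected_tree_two_colouring[OF assms] by blast
  from this[of x y] this[of y z] this[of z x] show ?thesis by blast
qed

text \<open>A 4-cycle is compatible with the 2-colouring, so parity does not exclude it as it does a
  triangle; here the four arcs themselves form a forbidden \<open>cycle\<close>.\<close>

lemma undirected_tree_no_4_cycle:
  assumes "graph T" and "undirected_tree T" and "distinct [w, x, y, z]"
  shows "\<not> (w \<rightarrow>\<^bsub>T\<^esub> x \<and> x \<rightarrow>\<^bsub>T\<^esub> y \<and> y \<rightarrow>\<^bsub>T\<^esub> z \<and> z \<rightarrow>\<^bsub>T\<^esub> w)"
proof
  assume adj: "w \<rightarrow>\<^bsub>T\<^esub> x \<and> x \<rightarrow>\<^bsub>T\<^esub> y \<and> y \<rightarrow>\<^bsub>T\<^esub> z \<and> z \<rightarrow>\<^bsub>T\<^esub> w"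
  interpret graph T by fact
  from adj obtain a b c d where e: "{a, b, c, d} \<subseteq> arcs T"
    "tail T a = w" "head T a = x" "tail T b = x" "head T b = y"
    "tail T c = y" "head T c = z" "tail T d = z" "head T d = w"
    by (fastforce simp: arcs_ends_conv)
  then have "cycle [a, b, c, d]"
    using assms(3) by (auto simp: cycle_def awalk_simps intro!: exI[of _ w])
  then show False using assms(2) by (force simp: undirected_tree_def)
qed

section \<open>Triples in cliques as paths with two edges\<close>

lemma obtain_distinct_sublist:
  assumes "n \<le> card S"
  obtains xs where "set xs \<subseteq> S" and "distinct xs" and "length xs = n"
proof -
  obtain A where "A \<subseteq> S" "card A = n" "finite A"
    using assms by (rule obtain_subset_with_card_n)
  moreover then obtain xs where "set xs = A" "distinct xs"
    using finite_distinct_list by blast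
  ultimately show thesis using that distinct_card by metis
qed

text \<open>Only the second case has room for three vertices of a set, so paths with exactly two
  edges decide 3,2-independence and 3,2-cliques.\<close>

lemma (in wf_digraph) apath_length_le_2_cases:
  assumes "apath u p v" and "length p \<le> 2"
  obtains "length p \<le> 1" and "card (set (awalk_verts u p)) \<le> 2"
  | w where "length p = 2" and "awalk_verts u p = [u, w, v]" and "distinct [u, w, v]"
      and "u \<rightarrow> w" and "w \<rightarrow> v"
proof (cases "length p = 2")
  case True
  then obtain a b where p: "p = [a, b]" by (auto simp: length_Suc_conv numeral_2_eq_2)
  with assms show thesis
    by (intro that(2)[of "head G a"])
      (auto simp: apath_def awalk_simps in_arcs_imp_in_arcs_ends dest: in_arcs_imp_in_arcs_ends)
next
  case False
  with assms have "length p \<le> 1" by simp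
  moreover from this have "card (set (awalk_verts u p)) \<le> 2"
    using card_length[of "awalk_verts u p"] by (simp add: length_awalk_verts)
  ultimately show thesis by (rule that(1))
qed

text \<open>A path with at most two edges has at most three vertices, so one that contains the
  triple consists of it exactly. The adjacencies serve to bound cliques in trees; the path itself
  refutes triples when no two-edge shortest path exists.\<close>

lemma kd_clique_3_2_triple:
  assumes "wf_digraph H" and "kd_clique 3 2 H S" and "{x, y, z} \<subseteq> S" and "distinct [x, y, z]"
  obtains u w v where "{u, w, v} = {x, y, z}" and "u \<rightarrow>\<^bsub>H\<^esub> w" and "w \<rightarrow>\<^bsub>H\<^esub> v"
    and "\<exists>p. shortest_path H u p v \<and> length p = 2"
proof -
  interpret wf_digraph H by fact
  have card: "card {x, y, z} = 3" using assms(4) by simp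
  with assms obtain u p v where p: "shortest_path H u p v" "length p \<le> 2"
    and sub: "{x, y, z} \<subseteq> set (awalk_verts u p)"
    unfolding kd_clique_def by blast
  have "apath u p v" using p by (simp add: shortest_path_def)
  then show thesis using p(2)
  proof (cases rule: apath_length_le_2_cases)
    case 1
    then show thesis using card_mono[OF _ sub] card by simp
  next
    case (2 w)
    then have "card (set (awalk_verts u p)) = card {x, y, z}" using card by simp
    then have "{x, y, z} = set (awalk_verts u p)" using sub by (intro card_subset_eq) auto
    with 2 p(1) show thesis by (intro that[of u w v]) auto
  qed
qed

text \<open>Each of the four triples holds at least two edges and each edge lies in two triples, so
  four clique vertices would carry at least four edges, too many for a forest.\<close>

lemma card_kd_clique_le_3:
  assumes "graph T" and "undirected_tree T" and "subgraph H T" and "kd_clique 3 2 H S"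
  shows "card S \<le> 3"
proof (rule ccontr)
  assume "\<not> card S \<le> 3"
  then have "4 \<le> card S" by simp
  then obtain xs where "set xs \<subseteq> S" "distinct xs" "length xs = 4"
    by (rule obtain_distinct_sublist)
  then obtain w x y z where S: "{w, x, y, z} \<subseteq> S" and dist: "distinct [w, x, y, z]"
    by (auto simp: length_Suc_conv numeral_eq_Suc)
  interpret graph T by fact
  have wf: "wf_digraph H" using assms(3) by auto
  \<comment> \<open>The clique paths live in \<open>H\<close>, but cycles are excluded in
    \<open>T\<close>; edges of \<open>H\<close> are therefore read as edges of
    \<open>T\<close>.\<close>
  define E where "E u v \<longleftrightarrow> u \<rightarrow>\<^bsub>T\<^esub> v" for u v
  have sym: "E u v \<Longrightarrow> E v u" for u v by (auto simp: E_def intro: graph_symmetric)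
  have P3: "E a b \<and> E b c \<or> E b c \<and> E c a \<or> E c a \<and> E a b"
    if abc: "{a, b, c} \<subseteq> S" "distinct [a, b, c]" for a b c
  proof -
    obtain u m v where umv: "{u, m, v} = {a, b, c}" "E u m" "E m v"
      using kd_clique_3_2_triple[OF wf assms(4) abc] adj_mono[OF _ assms(3)]
      unfolding E_def by metis
    have "card {u, m, v} = 3" using umv(1) abc(2) by simp
    then have "m \<noteq> u" "m \<noteq> v" "u \<noteq> v" by (auto simp: card_insert_if split: if_splits)
    moreover have "u \<in> {a, b, c}" "m \<in> {a, b, c}" "v \<in> {a, b, c}" using umv(1) by blast+
    ultimately show ?thesis using umv(2,3) sym by fastforce
  qed
  have C3: "\<not> (E a b \<and> E b c \<and> E c a)" for a b c
    unfolding E_def using assms(1,2) by (rule undirected_tree_no_triangle)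
  have C4: "\<not> (E a b \<and> E b c \<and> E c d \<and> E d a)" if "distinct [a, b, c, d]" for a b c d
    unfolding E_def using assms(1,2) that by (rule undirected_tree_no_4_cycle)
  have paths: "E w x \<and> E x y \<or> E x y \<and> E y w \<or> E y w \<and> E w x"
    "E w x \<and> E x z \<or> E x z \<and> E z w \<or> E z w \<and> E w x"
    "E w y \<and> E y z \<or> E y z \<and> E z w \<or> E z w \<and> E w y"
    "E x y \<and> E y z \<or> E y z \<and> E z x \<or> E z x \<and> E x y"
    by (rule P3; use S dist in simp)+
  \<comment> \<open>Up to rotation and reversal these are the only three 4-cycles on four vertices.
    The rest is propositional reasoning about the atoms \<open>E\<close>.\<close>
  have no_C4: "\<not> (E w x \<and> E x y \<and> E y z \<and> E z w)" "\<not> (E w x \<and> E x z \<and> E z y \<and> E y w)"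
    "\<not> (E w y \<and> E y x \<and> E x z \<and> E z w)"
    by (rule C4; use dist in auto)+
  show False
    using paths no_C4 C3[of w x y] C3[of w x z] C3[of w y z] C3[of x y z]
      sym[of w x] sym[of w y] sym[of w z] sym[of x y] sym[of x z] sym[of y z]
      sym[of x w] sym[of y w] sym[of z w] sym[of y x] sym[of z x] sym[of z y]
    by satx
qed

section \<open>Evaluating both invariants\<close>

lemma kd_clique_number_eqI:
  assumes "kd_clique k d H S" and "\<And>A. kd_clique k d H A \<Longrightarrow> card A \<le> card S"
  shows "kd_clique_number k d H = card S"
  unfolding kd_clique_number_def using assms by (intro cSup_eq_maximum) auto

lemma kd_chromatic_number_eq_1:
  assumes "\<And>u p v. shortest_path H u p v \<Longrightarrow> length p \<le> d \<Longrightarrow>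
    card (verts H \<inter> set (pre_digraph.awalk_verts H u p)) < k"
  shows "kd_chromatic_number k d H = 1"
proof -
  have "kd_colorable k d H 1"
    unfolding kd_colorable_def using assms
    by (intro exI[of _ "\<lambda>_. 1"]) (auto simp: kd_independent_def)
  then show ?thesis
    unfolding kd_chromatic_number_def by (intro Least_equality) auto
qed

theorem proposition3p6:
  fixes T :: "('a, 'b) pre_digraph"
  assumes "graph T" and "undirected_tree T"
  shows "kd_perfect 3 2 T"
proof -
  have "int (kd_chromatic_number 3 2 H) = \<lceil>real (kd_clique_number 3 2 H) / 2\<rceil>"
    if H: "induced_subgraph H T" and ne: "verts H \<noteq> {}" for H
  proof -
    interpret T: graph T by fact
    have sub: "subgraph H T" using H by (rule induced_imp_subgraph)
    \<comment> \<open>\<open>H\<close> may be disconnected, so the tree lemmas are applied to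
      \<open>T\<close> and carried over along \<open>sub\<close>.\<close>
    interpret fin_digraph H using sub by (rule T.fin_digraph_subgraph)
    note wf = wf_digraph
    have cases: "length p \<le> 1 \<and> card (set (awalk_verts u p)) \<le> 2 \<or>
        (\<exists>w. length p = 2 \<and> awalk_verts u p = [u, w, v] \<and> distinct [u, w, v] \<and> u \<rightarrow>\<^bsub>H\<^esub> w \<and> w \<rightarrow>\<^bsub>H\<^esub> v)"
      if "shortest_path H u p v" "length p \<le> 2" for u p v
      using apath_length_le_2_cases[of u p v] that unfolding shortest_path_def by metis
    show ?thesis
    \<comment> \<open>The first case yields 2 as the ceiling of 3/2; the second yields 1 as the
      ceiling of 1/2 or 2/2.\<close>
    proof (cases "\<exists>u p v. shortest_path H u p v \<and> length p = 2")
      case True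
      then obtain u p v where p: "shortest_path H u p v" "length p = 2" by blast
      then obtain w where w: "awalk_verts u p = [u, w, v]" "distinct [u, w, v]"
          "u \<rightarrow>\<^bsub>H\<^esub> w" "w \<rightarrow>\<^bsub>H\<^esub> v"
        using cases by fastforce
      then have in_verts: "{u, w, v} \<subseteq> verts H" by (auto dest: adj_in_verts)
      have "kd_clique 3 2 H {u, w, v}"
        unfolding kd_clique_def using p w in_verts
        by (intro conjI allI impI exI[of _ u] exI[of _ p] exI[of _ v]) auto
      moreover have "card {u, w, v} = 3" using w by simp
      ultimately have omega: "kd_clique_number 3 2 H = 3"
        using kd_clique_number_eqI card_kd_clique_le_3[OF assms sub] by metis
      obtain f :: "'a \<Rightarrow> bool" where f: "\<And>u v. u \<rightarrow>\<^bsub>T\<^esub> v \<Longrightarrow> f u \<noteq> f v"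
        using undirected_tree_two_colouring[OF assms] by blast
      have indep: "kd_independent 3 2 H {v \<in> verts H. f v = b}" for b
      proof -
        have "card ({v \<in> verts H. f v = b} \<inter> set (awalk_verts x q)) < 3"
          if q: "shortest_path H x q y" "length q \<le> 2" for x q y
        proof (cases "card (set (awalk_verts x q)) \<le> 2")
          case True
          then show ?thesis
            using card_mono[of "set (awalk_verts x q)" "{v \<in> verts H. f v = b} \<inter> set (awalk_verts x q)"]
            by simp
        next
          case False
          with cases[OF q] obtain z where z: "awalk_verts x q = [x, z, y]" "distinct [x, z, y]"
            "x \<rightarrow>\<^bsub>H\<^esub> z" by auto
          \<comment> \<open>One bichromatic edge suffices: the class then misses a vertex of the
            path and keeps at most two of the three.\<close>
          have "f x \<noteq> f z" using f T.adj_mono[OF z(3) sub] by blast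
          then have "{v \<in> verts H. f v = b} \<inter> set (awalk_verts x q) \<subset> set (awalk_verts x q)"
            using z by auto
          then have "card ({v \<in> verts H. f v = b} \<inter> set (awalk_verts x q)) < card (set (awalk_verts x q))"
            by (intro psubset_card_mono) auto
          then show ?thesis using z by simp
        qed
        then show ?thesis by (auto simp: kd_independent_def)
      qed
      have "kd_colorable 3 2 H 2"
        unfolding kd_colorable_def
      proof (intro exI conjI ballI)
        fix i :: nat
        assume "i \<in> {1..2}"
        then have "{v \<in> verts H. (if f v then 1 else 2) = i} = {v \<in> verts H. f v = (i = 1)}"
          by auto
        then show "kd_independent 3 2 H {v \<in> verts H. (if f v then 1 else 2) = i}"
          using indep by simp
      qed auto
      moreover have "\<not> kd_colorable 3 2 H 1"
      proof
        assume "kd_colorable 3 2 H 1"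
        then obtain g where g: "g ` verts H \<subseteq> {1::nat}"
          "kd_independent 3 2 H {v \<in> verts H. g v = 1}"
          by (auto simp: kd_colorable_def)
        \<comment> \<open>With one colour the only class is \<open>verts H\<close>, which contains
          all three vertices of \<open>p\<close>.\<close>
        have "{v \<in> verts H. g v = 1} = verts H" using g(1) by auto
        with g(2) have "kd_independent 3 2 H (verts H)" by metis
        then have "shortest_path H u p v \<and> length p \<le> 2 \<longrightarrow>
            card (verts H \<inter> set (awalk_verts u p)) < 3"
          unfolding kd_independent_def by blast
        with p have "card (verts H \<inter> set (awalk_verts u p)) < 3" by simp
        moreover have "verts H \<inter> set (awalk_verts u p) = {u, w, v}" using in_verts w by auto
        ultimately show False using w by simp
      qed
      ultimately have "kd_chromatic_number 3 2 H = 2"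
        unfolding kd_chromatic_number_def
        by (intro Least_equality) (auto simp: not_less_eq_eq numeral_2_eq_2 le_Suc_eq intro: ccontr)
      with omega show ?thesis by simp
    next
      case False
      have "card (verts H \<inter> set (awalk_verts u p)) < 3"
        if "shortest_path H u p v" "length p \<le> 2" for u p v
        using cases[OF that] False that(1)
          card_mono[of "set (awalk_verts u p)" "verts H \<inter> set (awalk_verts u p)"] by force
      then have chi: "kd_chromatic_number 3 2 H = 1"
        by (rule kd_chromatic_number_eq_1)
      have le: "card S \<le> 2" if S: "kd_clique 3 2 H S" for S
      proof (rule ccontr)
        assume "\<not> card S \<le> 2"
        then have "3 \<le> card S" by simp
        then obtain xs where "set xs \<subseteq> S" "distinct xs" "length xs = 3"
          by (rule obtain_distinct_sublist)
        then obtain x y z where "{x, y, z} \<subseteq> S" "distinct [x, y, z]"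
          by (auto simp: length_Suc_conv numeral_eq_Suc)
        then show False using kd_clique_3_2_triple[OF wf S] False by metis
      qed
      \<comment> \<open>A singleton clique gives the lower bound 1. Whether the clique number is 1
        or 2 can stay open, since both give the same ceiling.\<close>
      obtain v where v: "v \<in> verts H" using ne by blast
      have "card A \<noteq> 3" if "A \<subseteq> {v}" for A
        using card_mono[OF _ that] by simp
      with v have "kd_clique 3 2 H {v}" by (simp add: kd_clique_def)
      then have "1 \<le> kd_clique_number 3 2 H"
        unfolding kd_clique_number_def using le
        by (intro cSup_upper2[of 1]) (auto intro!: bdd_aboveI[of _ 2] image_eqI[of _ _ "{v}"])
      moreover have "kd_clique_number 3 2 H \<le> 2"
        unfolding kd_clique_number_def using le \<open>kd_clique 3 2 H {v}\<close>
        by (intro cSup_least) auto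
      ultimately have "kd_clique_number 3 2 H = 1 \<or> kd_clique_number 3 2 H = 2" by linarith
      with chi show ?thesis by (auto simp: ceiling_eq_iff)
    qed
  qed
  then show ?thesis by (simp add: kd_perfect_def)
qed

end
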